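(* Let $n\geq 7$ and let $G$ be an edge-colored $K^{(3)}_n$ containing no rainbow copy of $\mathcal{L}$, with $|C(G)|\geq 3$. Then, after renumbering the colors if necessary, at least one of the following holds: (i) there exist two vertices $u,v$ such that every edge $e$ with $c(e)\neq 1$ satisfies $\{u,v\}\subseteq e$; (ii) $|C(G)|\in\{3,4,5\}$, and there exist a vertex $v$ and at most one edge $e\in E(G-v)$ such that all edges of $E(G-v)\setminus\{e\}$ have the same color; (iii) $|C(G)|=3$, and there exists an edge $e$ with $c(e)\neq 1$ such that every edge $f\in E(G)\setminus\{e\}$ with $c(f)\neq 1$ satisfies $|e\cap f|=2$.
   Context: An edge-coloring is any map $c$ from edges to colors; $C(G)$ is the set of colors used; a copy is rainbow if its edges have pairwise distinct colors. $K^{(3)}_n$ is the complete 3-uniform hypergraph on $n$ vertices; $G-v$ is the subhypergraph induced on $V(G)\setminus\{v\}$. The loose path $\mathcal{L}$ has edges $\{v_1v_2v_3,v_3v_4v_5,v_5v_6v_7\}$. *)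

theory Defs
  imports Main
begin

type_synonym 'a hypergraph = "'a set \<times> 'a set set"

abbreviation verts :: "'a hypergraph \<Rightarrow> 'a set" where
  "verts \<equiv> fst"

abbreviation edges :: "'a hypergraph \<Rightarrow> 'a set set" where
  "edges \<equiv> snd"

definition complete3 :: "'a set \<Rightarrow> 'a hypergraph" where
  "complete3 V = (V, {e. e \<subseteq> V \<and> card e = 3})"

definition del_vert :: "'a hypergraph \<Rightarrow> 'a \<Rightarrow> 'a hypergraph" where
  "del_vert G v = (verts G - {v}, {e \<in> edges G. e \<subseteq> verts G - {v}})"

text \<open>A coloring is a function on all vertex sets, of which only the values on edges matter.\<close>

definition colors :: "('a set \<Rightarrow> 'c) \<Rightarrow> 'a hypergraph \<Rightarrow> 'c set" where
  "colors c G = c ` edges G"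

definition is_copy :: "('b \<Rightarrow> 'a) \<Rightarrow> 'b hypergraph \<Rightarrow> 'a hypergraph \<Rightarrow> bool" where
  "is_copy \<phi> H G \<longleftrightarrow>
     inj_on \<phi> (verts H) \<and> \<phi> ` verts H \<subseteq> verts G \<and> (\<forall>e\<in>edges H. \<phi> ` e \<in> edges G)"

definition has_rainbow_copy :: "('a set \<Rightarrow> 'c) \<Rightarrow> 'b hypergraph \<Rightarrow> 'a hypergraph \<Rightarrow> bool" where
  "has_rainbow_copy c H G \<longleftrightarrow>
     (\<exists>\<phi>. is_copy \<phi> H G \<and> inj_on c ((\<lambda>e. \<phi> ` e) ` edges H))"

definition loose_path :: "nat hypergraph" where
  "loose_path = ({1..7}, {{1,2,3}, {3,4,5}, {5,6,7}})"

end

theory Submission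
  imports Defs
begin

text \<open>
  The key is a dominant color \<open>k\<close>: any two edges of distinct colors other than \<open>k\<close> meet in exactly
  two vertices. To find it, take disjoint edges \<open>e\<close> and \<open>f\<close> of distinct colors. A short
  analysis of loose paths shows that an edge \<open>g\<close> of a third color meets \<open>e\<close> or \<open>f\<close> in two vertices;
  say \<open>e\<close>. Then the color of \<open>f\<close> is dominant: moving \<open>f\<close> one vertex at a time, always inside seven
  vertices containing \<open>e\<close> and \<open>g\<close>, shows that every edge disjoint from \<open>e\<close> has the color of \<open>f\<close>,
  and likewise for \<open>g\<close>. So an edge of another color that meets \<open>g\<close> in a single vertex extends to a
  rainbow path by an edge disjoint from \<open>g\<close>.

  Given a dominant color, the other color classes are cross-2-intersecting families of triples. If
  all their edges pairwise meet in two vertices, they share a pair or lie in four vertices.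
  Otherwise some class contains two edges with a single common vertex \<open>a\<close>, and each edge of every
  other class consists of \<open>a\<close> and one further vertex from each of these two edges.
\<close>

text \<open>\<open>path\<close> speaks of seven named vertices with \<open>{r, s, t}\<close> as the
  middle edge. An edge of unknown color lying on two such paths, each with two known distinct
  colors, is typically left with the one color common to both; all recoloring below works this
  way.\<close>

locale rainbow_loose_path_free =
  fixes V :: "'a set" and c :: "'a set \<Rightarrow> 'c" and E :: "'a set set"
  defines "E \<equiv> {e. e \<subseteq> V \<and> card e = 3}"
  assumes finite_V: "finite V" and card_V: "card V \<ge> 7"
    and path: "\<lbrakk>distinct [p, q, r, s, t, u, v]; {p, q, r, s, t, u, v} \<subseteq> V\<rbrakk>
      \<Longrightarrow> c {p, q, r} = c {r, s, t} \<or> c {r, s, t} = c {t, u, v} \<or> c {p, q, r} = c {t, u, v}"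
begin

section \<open>Elementary facts on triples and their intersections\<close>

lemma edgeI: "\<lbrakk>distinct [p, q, r]; {p, q, r} \<subseteq> V\<rbrakk> \<Longrightarrow> {p, q, r} \<in> E"
  by (simp add: E_def)

lemma edgeE:
  assumes "e \<in> E"
  obtains p q r where "e = {p, q, r}" "distinct [p, q, r]" "{p, q, r} \<subseteq> V"
  using assms that by (auto simp: E_def card_3_iff)

lemma edge_finite: "e \<in> E \<Longrightarrow> finite e"
  using finite_subset[OF _ finite_V] by (simp add: E_def)

lemma edge_eqI: "\<lbrakk>e \<in> E; f \<in> E; e \<subseteq> f\<rbrakk> \<Longrightarrow> e = f"
  using card_subset_eq[OF edge_finite, of f e] by (simp add: E_def)

lemma edge_pairE:
  assumes "e \<in> E" "f \<in> E" "card (e \<inter> f) = 2"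
  obtains u v x y where "e = {u, v, x}" "f = {u, v, y}" "distinct [u, v, x, y]"
    "{u, v, x, y} \<subseteq> V"
proof -
  obtain u v where uv: "e \<inter> f = {u, v}" "u \<noteq> v"
    using assms(3) by (meson card_2_iff)
  have "{u, v} \<subseteq> e" "{u, v} \<subseteq> f" using uv by auto
  then have "card (e - {u, v}) = 1" "card (f - {u, v}) = 1"
    using assms uv(2) by (simp_all add: E_def card_Diff_subset)
  then obtain x y where xy: "e - {u, v} = {x}" "f - {u, v} = {y}"
    by (meson card_1_singletonE)
  have e: "e = {u, v, x}" and f: "f = {u, v, y}"
    using xy uv by auto
  have "distinct [u, v, x, y]"
    using xy uv by auto
  moreover have "{u, v, x, y} \<subseteq> V"
    using e f assms by (auto simp: E_def)
  ultimately show thesis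
    using that e f by blast
qed

lemma edge_pointE:
  assumes "e \<in> E" "f \<in> E" "card (e \<inter> f) = 1"
  obtains a x y z w where "e = {a, x, y}" "f = {a, z, w}" "distinct [a, x, y, z, w]"
    "{a, x, y, z, w} \<subseteq> V"
proof -
  obtain a where a: "e \<inter> f = {a}"
    using assms(3) card_1_singletonE by blast
  have "a \<in> e" "a \<in> f" using a by auto
  then have "card (e - {a}) = 2" "card (f - {a}) = 2"
    using assms by (simp_all add: E_def)
  then obtain x y z w where xy: "e - {a} = {x, y}" "x \<noteq> y" "f - {a} = {z, w}" "z \<noteq> w"
    by (metis card_2_iff)
  have e: "e = {a, x, y}" and f: "f = {a, z, w}"
    using xy a by auto
  have "distinct [a, x, y, z, w]"
    using xy a by auto
  moreover have "{a, x, y, z, w} \<subseteq> V"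
    using e f assms by (auto simp: E_def)
  ultimately show thesis
    using that e f by blast
qed

lemma edge_inter_cases:
  assumes "e \<in> E" "f \<in> E" "e \<noteq> f"
  shows "e \<inter> f = {} \<or> card (e \<inter> f) = 1 \<or> card (e \<inter> f) = 2"
proof -
  have fin: "finite e" and cards: "card e = 3"
    using edge_finite[OF assms(1)] assms(1) by (simp_all add: E_def)
  have "card (e \<inter> f) \<le> 3"
    using card_mono[OF fin, of "e \<inter> f"] cards by simp
  moreover have "card (e \<inter> f) \<noteq> 3"
    using card_subset_eq[OF fin, of "e \<inter> f"] cards edge_eqI[OF assms(1,2)] assms(3) by auto
  moreover have "card (e \<inter> f) = 0 \<Longrightarrow> e \<inter> f = {}"
    using fin by simp
  ultimately show ?thesis by linarith
qed

lemma fresh3: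
  assumes "finite X" "card X \<le> 4"
  obtains p q r where "distinct [p, q, r]" "{p, q, r} \<subseteq> V" "{p, q, r} \<inter> X = {}"
proof -
  have "3 \<le> card (V - X)"
    using assms card_V diff_card_le_card_Diff[of X V] by linarith
  then obtain T where "T \<subseteq> V - X" "card T = 3"
    by (meson obtain_subset_with_card_n)
  then show thesis
    using that by (auto simp: card_3_iff)
qed

lemma fresh2:
  assumes "finite X" "card X \<le> 5"
  obtains p q where "p \<noteq> q" "{p, q} \<subseteq> V" "{p, q} \<inter> X = {}"
proof -
  have "2 \<le> card (V - X)"
    using assms card_V diff_card_le_card_Diff[of X V] by linarith
  then obtain T where "T \<subseteq> V - X" "card T = 2"
    by (meson obtain_subset_with_card_n)
  then show thesis
    using that by (auto simp: card_2_iff)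
qed

section \<open>Disjoint edges of distinct colors\<close>

text \<open>Two edges sharing a pair cover only four vertices, so some edge avoids both, and its
  color differs from that of at least one of them. Edges sharing a single vertex reduce to this
  case.\<close>

lemma disjoint_bichromatic:
  assumes "e \<in> E" "f \<in> E" "c e \<noteq> c f"
  obtains e' f' where "e' \<in> E" "f' \<in> E" "e' \<inter> f' = {}" "c e' \<noteq> c f'"
proof -
  have two: "\<exists>e'\<in>E. \<exists>f'\<in>E. e' \<inter> f' = {} \<and> c e' \<noteq> c f'"
    if ef: "e \<in> E" "f \<in> E" "c e \<noteq> c f" "card (e \<inter> f) = 2" for e f
  proof -
    obtain u v x y where uv: "e = {u, v, x}" "f = {u, v, y}" "distinct [u, v, x, y]"
      using edge_pairE ef by metis
    obtain p q r where p: "distinct [p, q, r]" "{p, q, r} \<subseteq> V" "{p, q, r} \<inter> {u, v, x, y} = {}"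
      using fresh3[of "{u, v, x, y}"] uv(3) by auto
    have "{p, q, r} \<in> E" "e \<inter> {p, q, r} = {}" "f \<inter> {p, q, r} = {}"
      using p uv by (auto simp: edgeI)
    then show ?thesis
      using ef by metis
  qed
  consider "e \<inter> f = {}" | "card (e \<inter> f) = 1" | "card (e \<inter> f) = 2"
    using edge_inter_cases assms by blast
  then have "\<exists>e'\<in>E. \<exists>f'\<in>E. e' \<inter> f' = {} \<and> c e' \<noteq> c f'"
  proof cases
    case 2
    then obtain a x y z w where ef: "e = {a, x, y}" "f = {a, z, w}" "distinct [a, x, y, z, w]"
      "{a, x, y, z, w} \<subseteq> V"
      using edge_pointE assms by metis
    \<comment> \<open>This edge shares a pair with \<open>e\<close> and a pair with
      \<open>f\<close>, and it differs in color from one of them.\<close>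
    have "{a, x, z} \<in> E"
      using ef by (simp add: edgeI)
    moreover have "e \<inter> {a, x, z} = {a, x}" "f \<inter> {a, x, z} = {a, z}"
      using ef by auto
    then have "card (e \<inter> {a, x, z}) = 2" "card (f \<inter> {a, x, z}) = 2"
      using ef by auto
    ultimately show ?thesis
      using two[of e "{a, x, z}"] two[of f "{a, x, z}"] assms by metis
  qed (use two assms in auto)
  then show thesis using that by blast
qed

section \<open>Moving an edge of a third color inside seven vertices\<close>

text \<open>The first two paths force \<open>{v3, v6, v7}\<close> to have the color of
  \<open>{v4, v5, v6}\<close>; the last two then use it to force \<open>{v4, v5, v7}\<close>. The
  moving edge keeps \<open>v4\<close> and exchanges another vertex.\<close>

lemma recolor_step1:
  assumes "distinct [v1, v2, v3, v4, v5, v6, v7]" "{v1, v2, v3, v4, v5, v6, v7} \<subseteq> V"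
    and "c {v1, v2, v3} \<noteq> c {v1, v2, v4}" "c {v4, v5, v6} \<notin> {c {v1, v2, v3}, c {v1, v2, v4}}"
  shows "c {v4, v5, v7} = c {v4, v5, v6}"
  using assms path[of v1 v2 v4 v5 v6 v3 v7] path[of v1 v2 v3 v7 v6 v4 v5]
    path[of v1 v2 v4 v5 v7 v3 v6] path[of v1 v2 v3 v6 v7 v4 v5]
  by (simp add: insert_commute) (smt (verit))

text \<open>Here the moving edge gives up \<open>v4\<close>, the vertex it shares with
  \<open>{v1, v2, v4}\<close>.\<close>

lemma recolor_step2:
  assumes D: "distinct [v1, v2, v3, v4, v5, v6, v7]" "{v1, v2, v3, v4, v5, v6, v7} \<subseteq> V"
    and "c {v1, v2, v3} \<noteq> c {v1, v2, v4}" "c {v4, v5, v6} \<notin> {c {v1, v2, v3}, c {v1, v2, v4}}"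
  shows "c {v5, v6, v7} = c {v4, v5, v6}"
proof -
  have s: "c {v4, v5, v7} = c {v4, v5, v6}" "c {v4, v6, v7} = c {v4, v5, v6}"
    using recolor_step1[of v1 v2 v3 v4 v5 v6 v7] recolor_step1[of v1 v2 v3 v4 v6 v5 v7] assms
    by (auto simp: insert_commute)
  \<comment> \<open>The edge \<open>{v3, v5, v6}\<close> is forced first. Containing
    \<open>v3\<close>, \<open>v4\<close> and \<open>v7\<close>, the edge \<open>{v3, v4, v7}\<close>
    then serves as middle edge from either edge through \<open>v1\<close>, \<open>v2\<close> to
    \<open>{v5, v6, v7}\<close>.\<close>
  have "c {v3, v4, v7} = c {v4, v5, v6}"
    using s assms path[of v1 v2 v3 v7 v4 v5 v6] path[of v1 v2 v4 v7 v3 v5 v6]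
      path[of v1 v2 v4 v7 v5 v3 v6] path[of v1 v2 v3 v5 v6 v4 v7]
    by (simp add: insert_commute) (smt (verit))
  then show ?thesis
    using assms path[of v1 v2 v3 v4 v7 v5 v6] path[of v1 v2 v4 v3 v7 v5 v6]
    by (simp add: insert_commute) (smt (verit))
qed

text \<open>The moving edge takes in \<open>v7\<close>. First \<open>{v3, v6, v7}\<close> gets the
  color of \<open>{v4, v5, v6}\<close>, which leaves \<open>{v4, v5, v7}\<close> that color or the
  color of \<open>{v1, v2, v3}\<close>. In the latter case \<open>{v1, v3, v6}\<close> and then
  \<open>{v2, v3, v4}\<close> take the color of \<open>{v1, v2, v7}\<close>, and no color remains
  for \<open>{v1, v6, v7}\<close>.\<close>

lemma recolor_step3:
  assumes "distinct [v1, v2, v3, v4, v5, v6, v7]" "{v1, v2, v3, v4, v5, v6, v7} \<subseteq> V"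
    and "c {v1, v2, v3} \<noteq> c {v1, v2, v7}" "c {v4, v5, v6} \<notin> {c {v1, v2, v3}, c {v1, v2, v7}}"
  shows "c {v4, v5, v7} = c {v4, v5, v6}"
  using assms
    path[of v1 v2 v3 v7 v6 v4 v5] path[of v1 v2 v7 v3 v6 v4 v5]
    path[of v1 v2 v3 v6 v7 v4 v5]
    path[of v2 v7 v1 v3 v6 v4 v5] path[of v3 v6 v1 v2 v7 v4 v5]
    path[of v6 v1 v3 v2 v4 v5 v7] path[of v1 v7 v2 v3 v4 v5 v6]
    path[of v2 v3 v1 v7 v6 v4 v5] path[of v2 v3 v4 v5 v7 v1 v6]
    path[of v2 v3 v4 v5 v6 v1 v7]
  by (simp add: insert_commute) (smt (verit))

text \<open>Starting from \<open>f\<close>, bring in the vertex \<open>y\<close> of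
  \<open>g - e\<close> if it is missing (\<open>recolor_step3\<close>), exchange the other two
  vertices (\<open>recolor_step1\<close>), and finally drop \<open>y\<close> if \<open>h\<close>
  avoids it (\<open>recolor_step2\<close>).\<close>

lemma disjoint_edges_color:
  assumes "e \<in> E" "g \<in> E" "card (e \<inter> g) = 2" and "f \<in> E" "f \<inter> e = {}"
    and "c e \<noteq> c g" "c f \<noteq> c e" "c f \<noteq> c g"
    and "h \<in> E" "h \<inter> e = {}"
  shows "c h = c f"
proof -
  obtain u v x y where uv: "e = {u, v, x}" "g = {u, v, y}" "distinct [u, v, x, y]"
    "{u, v, x, y} \<subseteq> V"
    using edge_pairE assms(1-3) by metis
  have neq: "c {u, v, x} \<noteq> c {u, v, y}" "c f \<notin> {c {u, v, x}, c {u, v, y}}"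
    using assms uv by auto
  have swap: "c {y, p, r} = c f"
    if "c {y, p, q} = c f" "distinct [u, v, x, y, p, q]" "distinct [u, v, x, y, p, r]"
      "{p, q, r} \<subseteq> V" for p q r
    using recolor_step1[of u v x y p q r] that uv neq by (cases "q = r") auto
  have swap2: "c {y, p', q'} = c f"
    if "c {y, p, q} = c f" "distinct [u, v, x, y, p, q]" "distinct [u, v, x, y, p', q']"
      "{p, q, p', q'} \<subseteq> V" for p q p' q'
  proof (cases "p' = p")
    case True
    then show ?thesis using swap[of p q q'] that by auto
  next
    case False
    \<comment> \<open>Two exchanges suffice: \<open>q\<close> gives way to \<open>p'\<close>, then
      \<open>p\<close> to \<open>q'\<close>.\<close>
    then have "c {y, p, p'} = c f"
      using swap[of p q p'] that by auto
    then have "c {y, p', p} = c f"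
      by (simp add: insert_commute)
    then show ?thesis
      using swap[of p' p q'] that False by auto
  qed
  obtain p q where pq: "c {y, p, q} = c f" "distinct [u, v, x, y, p, q]" "{p, q} \<subseteq> V"
  proof -
    obtain p q r where f: "f = {p, q, r}" "distinct [p, q, r]" "{p, q, r} \<subseteq> V"
      using edgeE assms(4) by metis
    have fd: "distinct [u, v, x, p]" "distinct [u, v, x, q]" "distinct [u, v, x, r]"
      using f uv assms(5) by auto
    consider "y = p" | "y = q" | "y = r" | "y \<notin> {p, q, r}"
      by blast
    then show thesis
    proof cases
      case 1
      then show thesis using that[of q r] f fd uv by auto
    next
      case 2
      then show thesis using that[of p r] f fd uv by (auto simp: insert_commute)
    next
      case 3
      then show thesis using that[of p q] f fd uv by (auto simp: insert_commute)
    next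
      case 4
      then have "c {p, q, y} = c f"
        using recolor_step3[of u v x p q r y] f fd uv neq by auto
      then show thesis
        using that[of p q] f fd uv 4 by (auto simp: insert_commute)
    qed
  qed
  have y: "c {y, p', q'} = c f" if "distinct [u, v, x, y, p', q']" "{p', q'} \<subseteq> V" for p' q'
    using swap2[of p q p' q'] pq that by auto
  obtain p' q' r' where h: "h = {p', q', r'}" "distinct [p', q', r']" "{p', q', r'} \<subseteq> V"
    using edgeE assms(9) by metis
  have hd: "distinct [u, v, x, p']" "distinct [u, v, x, q']" "distinct [u, v, x, r']"
    using h uv assms(10) by auto
  consider "y = p'" | "y = q'" | "y = r'" | "y \<notin> {p', q', r'}"
    by blast
  then show ?thesis
  proof cases
    case 1
    then show ?thesis using y[of q' r'] h hd uv by auto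
  next
    case 2
    then show ?thesis using y[of p' r'] h hd uv by (auto simp: insert_commute)
  next
    case 3
    then show ?thesis using y[of p' q'] h hd uv by (auto simp: insert_commute)
  next
    case 4
    have "c {y, p', q'} = c f"
      using y[of p' q'] h hd uv 4 by auto
    then show ?thesis
      using recolor_step2[of u v x y p' q' r'] h hd uv neq 4 by auto
  qed
qed

lemma dominated_inter:
  assumes "e \<in> E" "g \<in> E" "card (e \<inter> g) = 2" and "f \<in> E" "f \<inter> e = {}"
    and "c e \<noteq> c g" "c f \<noteq> c e" "c f \<noteq> c g"
    and "h \<in> E" "c h \<noteq> c f"
  shows "c h \<noteq> c g \<Longrightarrow> card (h \<inter> g) = 2" and "c h \<noteq> c e \<Longrightarrow> card (h \<inter> e) = 2"
proof -
  \<comment> \<open>Stated for any edge \<open>g\<close> whose disjoint edges all have the color of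
    \<open>f\<close>, so that it applies to both \<open>e\<close> and \<open>g\<close>. If
    \<open>h\<close> met \<open>g\<close> in one vertex only, then \<open>g\<close>,
    \<open>h\<close> and an edge \<open>{y, p, q}\<close> avoiding \<open>g\<close> would form a
    rainbow path.\<close>
  have dom: "card (h \<inter> g) = 2"
    if g: "g \<in> E" "c g \<noteq> c f" "c h \<noteq> c g" and disj: "\<And>k. \<lbrakk>k \<in> E; k \<inter> g = {}\<rbrakk> \<Longrightarrow> c k = c f" for g
  proof -
    have "h \<inter> g \<noteq> {}" "h \<noteq> g"
      using disj[of h] assms(9,10) g(3) by auto
    moreover have "card (h \<inter> g) \<noteq> 1"
    proof
      assume "card (h \<inter> g) = 1"
      then obtain a x y z w where hg: "h = {a, x, y}" "g = {a, z, w}" "distinct [a, x, y, z, w]"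
        "{a, x, y, z, w} \<subseteq> V"
        using edge_pointE[OF assms(9) g(1)] by metis
      obtain p q where p: "p \<noteq> q" "{p, q} \<subseteq> V" "{p, q} \<inter> {a, x, y, z, w} = {}"
        using fresh2[of "{a, x, y, z, w}"] hg(3) by auto
      have "{y, p, q} \<in> E" "{y, p, q} \<inter> g = {}"
        using p hg by (auto simp: edgeI)
      then have "c {y, p, q} = c f"
        by (rule disj)
      then show False
        using path[of z w a x y p q] hg p g(2,3) assms(10) by (auto simp: insert_commute)
    qed
    ultimately show ?thesis
      using edge_inter_cases[OF assms(9) g(1)] by blast
  qed
  note disj_e = disjoint_edges_color[OF assms(1-8)]
  show "card (h \<inter> e) = 2" if "c h \<noteq> c e"
    by (rule dom[OF assms(1) assms(7)[symmetric] that]) (rule disj_e)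
  obtain u v x y where uv: "e = {u, v, x}" "g = {u, v, y}" "distinct [u, v, x, y]"
    using edge_pairE assms(1-3) by metis
  \<comment> \<open>Since \<open>f\<close> may meet \<open>g\<close>, it is replaced by an edge of
    the same color disjoint from both \<open>e\<close> and \<open>g\<close>; then the roles of
    \<open>e\<close> and \<open>g\<close> can be exchanged.\<close>
  obtain p q r where p: "distinct [p, q, r]" "{p, q, r} \<subseteq> V" "{p, q, r} \<inter> {u, v, x, y} = {}"
    using fresh3[of "{u, v, x, y}"] uv(3) by auto
  have f': "{p, q, r} \<in> E" "{p, q, r} \<inter> e = {}" "{p, q, r} \<inter> g = {}"
    using p uv by (auto simp: edgeI)
  have cf': "c {p, q, r} = c f"
    using disj_e f' by blast
  have disj_g: "c k = c f" if "k \<in> E" "k \<inter> g = {}" for k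
    using disjoint_edges_color[of g e "{p, q, r}" k] f' cf' assms that by (simp add: Int_commute)
  show "card (h \<inter> g) = 2" if "c h \<noteq> c g"
    by (rule dom[OF assms(2) assms(8)[symmetric] that]) (rule disj_g)
qed

section \<open>Third colors and the dominant color\<close>

text \<open>Were the color of \<open>{v1, x, y}\<close> a third one, \<open>{v2, x, v6}\<close> and
  \<open>{v3, x, v6}\<close> would be forced to the color of \<open>{v4, v5, v6}\<close>, and
  \<open>{v2, v4, v5}\<close> to the third color. Then \<open>{v4, v5, v2}\<close>,
  \<open>{v2, v1, v3}\<close>, \<open>{v3, x, v6}\<close> is a rainbow path.\<close>

lemma third_color_far:
  assumes "distinct [v1, v2, v3, v4, v5, v6, x, y]" "{v1, v2, v3, v4, v5, v6, x, y} \<subseteq> V"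
    and "c {v1, v2, v3} \<noteq> c {v4, v5, v6}"
  shows "c {v1, x, y} \<in> {c {v1, v2, v3}, c {v4, v5, v6}}"
  using assms path[of v1 v3 v2 x v6 v4 v5] path[of v1 y x v2 v6 v4 v5]
    path[of v1 v2 v3 x v6 v4 v5] path[of v1 y x v3 v6 v4 v5]
    path[of x y v1 v3 v2 v4 v5] path[of v1 y x v6 v2 v4 v5] path[of v4 v5 v2 v1 v3 x v6]
  by (simp add: insert_commute) (smt (verit))

lemma third_color_inter:
  assumes "e \<in> E" "f \<in> E" "e \<inter> f = {}" "c e \<noteq> c f" "g \<in> E" "c g \<noteq> c e" "c g \<noteq> c f"
  shows "card (g \<inter> e) = 2 \<or> card (g \<inter> f) = 2"
proof (rule ccontr)
  assume neg: "\<not> ?thesis"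
  have one: False
    if ef: "e \<in> E" "f \<in> E" "e \<inter> f = {}" "c e \<noteq> c f" "c g \<noteq> c e" "c g \<noteq> c f"
      "card (g \<inter> e) = 1" "card (g \<inter> f) \<noteq> 2" for e f
  proof -
    obtain a x y z w where eg: "g = {a, x, y}" "e = {a, z, w}" "distinct [a, x, y, z, w]"
      "{a, x, y, z, w} \<subseteq> V"
      using edge_pointE assms(5) ef by metis
    consider "g \<inter> f = {}" | "card (g \<inter> f) = 1"
      using edge_inter_cases[of g f] assms(5) ef by auto
    then show False
    proof cases
      case 1
      obtain p q r where f: "f = {p, q, r}" "distinct [p, q, r]" "{p, q, r} \<subseteq> V"
        using edgeE ef(2) by metis
      show False
        using third_color_far[of a z w p q r x y] f eg ef 1 by auto
    next
      case 2
      then obtain b s t k l where fg: "g = {b, s, t}" "f = {b, k, l}" "distinct [b, s, t, k, l]"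
        "{b, s, t, k, l} \<subseteq> V"
        using edge_pointE[of g f] assms(5) ef by metis
      have "b \<noteq> a" "b \<in> {x, y}"
        using fg eg ef(3) by auto
      \<comment> \<open>Meeting each of \<open>e\<close> and \<open>f\<close> in one vertex,
        \<open>g\<close> is the middle edge of a rainbow path from \<open>e\<close> to
        \<open>f\<close>.\<close>
      then obtain d where d: "g = {a, d, b}" "d \<in> {x, y}" "d \<noteq> b"
        using eg by (auto simp: insert_commute)
      have "d \<notin> f"
        using d fg \<open>b \<noteq> a\<close> eg by auto
      then show False
        using path[of z w a d b k l] d eg fg ef by (auto simp: insert_commute)
    qed
  qed
  have "card (g \<inter> e) \<noteq> 1" "card (g \<inter> f) \<noteq> 1"
    using one[of e f] one[of f e] assms neg by (auto simp: Int_commute)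
  then have ge: "g \<inter> e = {}" and gf: "g \<inter> f = {}"
    using edge_inter_cases[of g e] edge_inter_cases[of g f] assms neg by auto
  obtain v1 v2 v3 where e: "e = {v1, v2, v3}" "distinct [v1, v2, v3]" "{v1, v2, v3} \<subseteq> V"
    using edgeE assms(1) by metis
  obtain v4 v5 v6 where f: "f = {v4, v5, v6}" "distinct [v4, v5, v6]" "{v4, v5, v6} \<subseteq> V"
    using edgeE assms(2) by metis
  obtain v7 v8 v9 where g: "g = {v7, v8, v9}" "distinct [v7, v8, v9]" "{v7, v8, v9} \<subseteq> V"
    using edgeE assms(5) by metis
  have D: "distinct [v1, v2, v3, v4, v5, v6, v7, v8, v9]"
    using e f g ge gf assms(3) by auto
  \<comment> \<open>A transversal of three disjoint edges joins any two of them into a path, so its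
    color lies in all three pairs of colors, which have no common element.\<close>
  have "c {v1, v4, v7} \<in> {c e, c f}"
    using path[of v2 v3 v1 v7 v4 v5 v6] D e f g assms by (auto simp: insert_commute)
  moreover have "c {v1, v4, v7} \<in> {c e, c g}"
    using path[of v2 v3 v1 v4 v7 v8 v9] D e f g assms by (auto simp: insert_commute)
  moreover have "c {v1, v4, v7} \<in> {c f, c g}"
    using path[of v5 v6 v4 v1 v7 v8 v9] D e f g assms by (auto simp: insert_commute)
  ultimately show False
    using assms by auto
qed

lemma third_color_exists:
  assumes "3 \<le> card (c ` E)"
  shows "\<exists>g\<in>E. c g \<noteq> a \<and> c g \<noteq> b"
proof (rule ccontr)
  assume "\<not> ?thesis"
  then have "c ` E \<subseteq> {a, b}" by blast
  then have "card (c ` E) \<le> card {a, b}"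
    by (intro card_mono) auto
  also have "\<dots> \<le> 2"
    by (simp add: card_insert_if)
  finally show False
    using assms by linarith
qed

lemma dominant_color:
  assumes "3 \<le> card (c ` E)"
  obtains k where "k \<in> c ` E"
    "\<And>e f. \<lbrakk>e \<in> E; f \<in> E; c e \<noteq> k; c f \<noteq> k; c e \<noteq> c f\<rbrakk> \<Longrightarrow> card (e \<inter> f) = 2"
proof -
  note other = third_color_exists[OF assms]
  obtain e0 f0 where "e0 \<in> E" "f0 \<in> E" "c e0 \<noteq> c f0"
    using other by metis
  then obtain e f where ef: "e \<in> E" "f \<in> E" "e \<inter> f = {}" "c e \<noteq> c f"
    using disjoint_bichromatic by blast
  have dom: "card (h1 \<inter> h2) = 2"
    if ef: "e \<in> E" "f \<in> E" "e \<inter> f = {}" "c e \<noteq> c f"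
      and g: "g \<in> E" "c g \<noteq> c e" "c g \<noteq> c f" "card (g \<inter> e) = 2"
      and h: "h1 \<in> E" "h2 \<in> E" "c h1 \<noteq> c f" "c h2 \<noteq> c f" "c h1 \<noteq> c h2" for e f g h1 h2
  proof -
    \<comment> \<open>At most one of \<open>h1\<close>, \<open>h2\<close> has the color of
      \<open>e\<close>; here \<open>h2\<close> does not. It then meets \<open>e\<close> in a pair
      and can replace \<open>g\<close> in \<open>dominated_inter\<close>.\<close>
    have *: "card (h1 \<inter> h2) = 2"
      if h: "h1 \<in> E" "h2 \<in> E" "c h1 \<noteq> c f" "c h2 \<noteq> c f" "c h1 \<noteq> c h2" "c h2 \<noteq> c e" for h1 h2
    proof -
      have "card (h2 \<inter> e) = 2"
        using dominated_inter(2)[of e g f h2] ef g h by (auto simp: Int_commute)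
      then show ?thesis
        using dominated_inter(1)[of e h2 f h1] ef h by (auto simp: Int_commute)
    qed
    show ?thesis
      using *[of h1 h2] *[of h2 h1] h by (cases "c h2 = c e") (auto simp: Int_commute)
  qed
  obtain g where g: "g \<in> E" "c g \<noteq> c e" "c g \<noteq> c f"
    using other by blast
  then consider "card (g \<inter> e) = 2" | "card (g \<inter> f) = 2"
    using third_color_inter ef by metis
  then show thesis
  proof cases
    case 1
    then show thesis
      using that[of "c f"] dom[of e f g] ef g by auto
  next
    case 2
    then show thesis
      using that[of "c e"] dom[of f e g] ef g by (auto simp: Int_commute)
  qed
qed

section \<open>Structure of the edges outside the dominant color\<close>

lemma card_inter_triple_eq_2:
  assumes "distinct [p, q, r]"
  shows "card (f \<inter> {p, q, r}) = 2 \<longleftrightarrow>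
    p \<in> f \<and> q \<in> f \<and> r \<notin> f \<or> p \<in> f \<and> q \<notin> f \<and> r \<in> f \<or> p \<notin> f \<and> q \<in> f \<and> r \<in> f"
  using assms by (auto simp: Int_insert_right card_insert_if)

lemma edge_eq_triple:
  assumes "f \<in> E" "distinct [p, q, r]" "{p, q, r} \<subseteq> f"
  shows "f = {p, q, r}"
  using assms edge_finite[OF assms(1)] card_subset_eq[of f "{p, q, r}"] by (simp add: E_def)

lemma edge_not_quadruple:
  assumes "f \<in> E" "distinct [p, q, r, s]"
  shows "\<not> {p, q, r, s} \<subseteq> f"
  using card_mono[OF edge_finite[OF assms(1)], of "{p, q, r, s}"] assms by (auto simp: E_def)

definition common_pair :: "'c \<Rightarrow> bool" where
  "common_pair k \<longleftrightarrow> (\<exists>u\<in>V. \<exists>v\<in>V. u \<noteq> v \<and> (\<forall>e\<in>E. c e \<noteq> k \<longrightarrow> {u, v} \<subseteq> e))"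

text \<open>The exceptional \<open>g\<close> ranges over all sets, so the case without an
  exceptional edge is included.\<close>

definition almost_common_vertex :: "'c \<Rightarrow> bool" where
  "almost_common_vertex k \<longleftrightarrow> (\<exists>v\<in>V. \<exists>g. \<forall>e\<in>E. c e \<noteq> k \<longrightarrow> v \<notin> e \<longrightarrow> e = g)"

definition around_edge :: "'c \<Rightarrow> bool" where
  "around_edge k \<longleftrightarrow>
     (\<exists>e\<in>E. c e \<noteq> k \<and> (\<forall>f\<in>E - {e}. c f \<noteq> k \<longrightarrow> card (e \<inter> f) = 2))"

text \<open>Two such edges span four vertices \<open>u\<close>, \<open>v\<close>, \<open>x\<close>,
  \<open>y\<close>. A third one not containing their common pair is also a triple of these four
  vertices, and this confines all further ones to the same set: at most four edges, hence at most
  five colors with \<open>k\<close>.\<close>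

lemma structure_if_pairwise:
  assumes col: "3 \<le> card (c ` E)"
    and pw: "\<And>e f. \<lbrakk>e \<in> E; f \<in> E; c e \<noteq> k; c f \<noteq> k; e \<noteq> f\<rbrakk> \<Longrightarrow> card (e \<inter> f) = 2"
  shows "common_pair k \<or> card (c ` E) \<in> {3, 4, 5} \<and> almost_common_vertex k
    \<or> card (c ` E) = 3 \<and> around_edge k"
proof -
  obtain e where e: "e \<in> E" "c e \<noteq> k"
    using third_color_exists[OF col] by blast
  obtain f where f: "f \<in> E" "c f \<noteq> k" "c f \<noteq> c e"
    using third_color_exists[OF col] by blast
  have "e \<noteq> f" using f by auto
  then have "card (e \<inter> f) = 2"
    using pw e f by blast
  then obtain u v x y where ef: "e = {u, v, x}" "f = {u, v, y}" "distinct [u, v, x, y]"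
    "{u, v, x, y} \<subseteq> V"
    using edge_pairE e(1) f(1) by metis
  show ?thesis
  proof (cases "\<forall>h\<in>E. c h \<noteq> k \<longrightarrow> {u, v} \<subseteq> h")
    case True
    then show ?thesis
      using ef unfolding common_pair_def by auto
  next
    case False
    then obtain h where h: "h \<in> E" "c h \<noteq> k" "\<not> {u, v} \<subseteq> h"
      by blast
    then have "h \<noteq> e" "h \<noteq> f"
      using ef by auto
    then have "card (h \<inter> {u, v, x}) = 2" "card (h \<inter> {u, v, y}) = 2"
      using pw[of h e] pw[of h f] e f h ef by auto
    then have "(u \<in> h \<or> v \<in> h) \<and> x \<in> h \<and> y \<in> h"
      using card_inter_triple_eq_2[of u v x h] card_inter_triple_eq_2[of u v y h] ef(3) h(3)
      by auto
    then have "h = {u, x, y} \<or> h = {v, x, y}"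
      using edge_eq_triple[OF h(1), of u x y] edge_eq_triple[OF h(1), of v x y] ef(3) by auto
    \<comment> \<open>The vertex \<open>u'\<close> is the one of \<open>u\<close>, \<open>v\<close>
      lying in \<open>h\<close>, so that only the fourth triple \<open>{v', x, y}\<close> avoids
      it.\<close>
    then obtain u' v' where uv: "h = {u', x, y}" "e = {u', v', x}" "f = {u', v', y}"
      "distinct [u', v', x, y]" "{u', v', x, y} \<subseteq> V"
    proof (elim disjE)
      assume "h = {u, x, y}"
      then show thesis using that[of u v] ef by auto
    next
      assume "h = {v, x, y}"
      then show thesis using that[of v u] ef by auto
    qed
    have K4: "g \<in> {e, f, h, {v', x, y}}" if g: "g \<in> E" "c g \<noteq> k" for g
    proof (rule ccontr)
      assume neg: "g \<notin> {e, f, h, {v', x, y}}"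
      then have "card (g \<inter> {u', v', x}) = 2" "card (g \<inter> {u', v', y}) = 2" "card (g \<inter> {u', x, y}) = 2"
        using pw[of g e] pw[of g f] pw[of g h] e f h uv g by auto
      then have "{v', x, y} \<subseteq> g"
        using card_inter_triple_eq_2[of u' v' x g] card_inter_triple_eq_2[of u' v' y g]
          card_inter_triple_eq_2[of u' x y g] uv(4) by auto
      then show False
        using edge_eq_triple[OF g(1), of v' x y] uv(4) neg by auto
    qed
    have "c ` E \<subseteq> {k, c e, c f, c h, c {v', x, y}}"
      using K4 by blast
    then have "card (c ` E) \<le> card {k, c e, c f, c h, c {v', x, y}}"
      by (intro card_mono) auto
    also have "\<dots> \<le> 5"
      by (simp add: card_insert_if)
    finally have range: "card (c ` E) \<in> {3, 4, 5}"
      using col by auto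
    have "\<forall>g\<in>E. c g \<noteq> k \<longrightarrow> u' \<notin> g \<longrightarrow> g = {v', x, y}"
      using K4 uv by blast
    moreover have "u' \<in> V" using uv(5) by simp
    ultimately have "almost_common_vertex k"
      unfolding almost_common_vertex_def by blast
    with range show ?thesis by simp
  qed
qed

text \<open>An edge of a further color meets \<open>e\<close> and \<open>e'\<close> in two vertices
  each, which is too much if they are disjoint; so they share one vertex \<open>a\<close>. If there
  is only one edge of further color, it is the center for \<open>around_edge\<close>; otherwise
  \<open>a\<close> is the almost common vertex.\<close>

lemma structure_if_spread_class:
  assumes col: "3 \<le> card (c ` E)"
    and cross: "\<And>e f. \<lbrakk>e \<in> E; f \<in> E; c e \<noteq> k; c f \<noteq> k; c e \<noteq> c f\<rbrakk> \<Longrightarrow> card (e \<inter> f) = 2"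
    and e: "e \<in> E" "c e \<noteq> k" and e': "e' \<in> E" "c e' = c e" "e' \<noteq> e" "card (e \<inter> e') \<noteq> 2"
  shows "common_pair k \<or> card (c ` E) \<in> {3, 4, 5} \<and> almost_common_vertex k
    \<or> card (c ` E) = 3 \<and> around_edge k"
proof -
  define R where "R = {f \<in> E. c f \<noteq> k \<and> c f \<noteq> c e}"
  have R2: "card (f \<inter> e) = 2" "card (f \<inter> e') = 2" if "f \<in> R" for f
    using cross[of f e] cross[of f e'] that e e' by (auto simp: R_def)
  obtain f where f: "f \<in> R"
    using third_color_exists[OF col, of k "c e"] by (auto simp: R_def)
  have "e \<inter> e' \<noteq> {}"
  proof
    assume "e \<inter> e' = {}"
    then have "card ((f \<inter> e) \<union> (f \<inter> e')) = 4"
      using R2[OF f] edge_finite e(1) e'(1) by (subst card_Un_disjoint) auto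
    moreover have "card ((f \<inter> e) \<union> (f \<inter> e')) \<le> card f"
      using f edge_finite by (intro card_mono) (auto simp: R_def)
    ultimately show False
      using f by (simp add: R_def E_def)
  qed
  then have "card (e \<inter> e') = 1"
    using edge_inter_cases[OF e(1) e'(1)] e'(3,4) by auto
  then obtain a x y z w where axy: "e = {a, x, y}" "e' = {a, z, w}" "distinct [a, x, y, z, w]"
    "{a, x, y, z, w} \<subseteq> V"
    using edge_pointE[OF e(1) e'(1)] by metis
  have Rform: "g \<in> {{a, x, z}, {a, x, w}, {a, y, z}, {a, y, w}}" if g: "g \<in> R" for g
  proof -
    have gE: "g \<in> E" using g by (simp add: R_def)
    have "card (g \<inter> {a, x, y}) = 2" "card (g \<inter> {a, z, w}) = 2"
      using R2[OF g] axy by auto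
    \<comment> \<open>Without \<open>a\<close>, the edge \<open>g\<close> would have to contain all
      four of these vertices.\<close>
    moreover have "\<not> {x, y, z, w} \<subseteq> g"
      using edge_not_quadruple[OF gE] axy by auto
    ultimately have "a \<in> g" "x \<in> g \<or> y \<in> g" "z \<in> g \<or> w \<in> g"
      using card_inter_triple_eq_2[of a x y g] card_inter_triple_eq_2[of a z w g] axy(3) by auto
    then show ?thesis
      using edge_eq_triple[OF gE, of a x z] edge_eq_triple[OF gE, of a x w]
        edge_eq_triple[OF gE, of a y z] edge_eq_triple[OF gE, of a y w] axy(3) by auto
  qed
  show ?thesis
  proof (cases "\<exists>f'\<in>R. f' \<noteq> f")
    case True
    then obtain f' where f': "f' \<in> R" "f' \<noteq> f"
      by blast
    \<comment> \<open>Opposite edges of the 4-cycle \<open>xzyw\<close> in the link of \<open>a\<close> cannot receive distinct colors,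
      so the class of \<open>e\<close> leaves room for at most two further colors besides \<open>k\<close>.\<close>
    have opp: "\<exists>d. \<forall>g\<in>{g1, g2}. g \<in> R \<longrightarrow> c g = d"
      if "card (g1 \<inter> g2) \<noteq> 2" for g1 g2
    proof -
      have "c g1 = c g2" if "g1 \<in> R" "g2 \<in> R"
        using cross[of g1 g2] \<open>card (g1 \<inter> g2) \<noteq> 2\<close> that unfolding R_def by blast
      then show ?thesis by (cases "g1 \<in> R") auto
    qed
    have "{a, x, z} \<inter> {a, y, w} = {a}" "{a, x, w} \<inter> {a, y, z} = {a}"
      using axy(3) by auto
    then have "card ({a, x, z} \<inter> {a, y, w}) \<noteq> 2" "card ({a, x, w} \<inter> {a, y, z}) \<noteq> 2"
      by (metis One_nat_def Suc_1 card_1_singleton_iff n_not_Suc_n)+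
    then obtain d1 d2 where d: "\<forall>g\<in>{{a, x, z}, {a, y, w}}. g \<in> R \<longrightarrow> c g = d1"
      "\<forall>g\<in>{{a, x, w}, {a, y, z}}. g \<in> R \<longrightarrow> c g = d2"
      using opp[of "{a, x, z}" "{a, y, w}"] opp[of "{a, x, w}" "{a, y, z}"] by metis
    have "c g \<in> {k, c e, d1, d2}" if "g \<in> E" for g
    proof (cases "g \<in> R")
      case True
      then show ?thesis using Rform[OF True] d by auto
    next
      case False
      then show ?thesis using that by (auto simp: R_def)
    qed
    then have "card (c ` E) \<le> card {k, c e, d1, d2}"
      by (intro card_mono) auto
    also have "\<dots> \<le> 5"
      by (simp add: card_insert_if)
    finally have range: "card (c ` E) \<in> {3, 4, 5}"
      using col by auto
    \<comment> \<open>An edge \<open>g\<close> avoiding \<open>a\<close> has the color of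
      \<open>e\<close>, so it meets \<open>f\<close> and \<open>f'\<close> in two vertices each and
      contains both without \<open>a\<close>. As \<open>f\<close> and \<open>f'\<close> differ,
      these vertices already number at least three and determine \<open>g\<close>.\<close>
    have "g = (f \<union> f') - {a}" if g: "g \<in> E" "a \<notin> g" "c g \<noteq> k" for g
    proof -
      have aR: "a \<in> h" if "h \<in> R" for h
        using Rform[OF that] by auto
      have "g \<notin> R" using aR g(2) by blast
      then have cg: "c g = c e" using g by (simp add: R_def)
      have sub: "h - {a} \<subseteq> g" if h: "h \<in> R" for h
      proof -
        have fin: "finite h" and h3: "card h = 3" and hE: "h \<in> E"
          using h edge_finite[of h] by (auto simp: R_def E_def)
        have "card (h \<inter> g) = 2"
          using cross[of h g] h g cg by (auto simp: R_def)
        moreover have "h \<inter> g \<subseteq> h - {a}" using g(2) by auto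
        moreover have "card (h - {a}) = 2" using h3 aR[OF h] by simp
        ultimately have "h \<inter> g = h - {a}"
          using card_subset_eq[of "h - {a}" "h \<inter> g"] fin by simp
        then show ?thesis by blast
      qed
      have "g \<subseteq> (f \<union> f') - {a}"
      proof (rule ccontr)
        assume "\<not> ?thesis"
        then have "(f \<union> f') - {a} \<subset> g"
          using sub[OF f] sub[OF f'(1)] by blast
        then have "card ((f \<union> f') - {a}) < 3"
          using psubset_card_mono[OF edge_finite[OF g(1)]] g(1) by (auto simp: E_def)
        then have "card (f \<union> f') \<le> 3"
          using aR[OF f] by simp
        moreover have "f \<subseteq> f \<union> f'" "f' \<subseteq> f \<union> f'" "finite (f \<union> f')" "card f = 3" "card f' = 3"
          using f f'(1) edge_finite[of f] edge_finite[of f'] by (auto simp: R_def E_def)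
        ultimately have "f = f \<union> f'" "f' = f \<union> f'"
          using card_seteq by metis+
        then show False using f' by simp
      qed
      then show ?thesis
        using sub[OF f] sub[OF f'(1)] by blast
    qed
    then have "\<forall>g\<in>E. c g \<noteq> k \<longrightarrow> a \<notin> g \<longrightarrow> g = (f \<union> f') - {a}" by blast
    moreover have "a \<in> V" using axy(4) by simp
    ultimately have "almost_common_vertex k"
      unfolding almost_common_vertex_def by blast
    with range show ?thesis by simp
  next
    case False
    then have R1: "R = {f}" using f by blast
    then have "c ` E \<subseteq> {k, c e, c f}"
      by (auto simp: R_def)
    then have "card (c ` E) \<le> card {k, c e, c f}"
      by (intro card_mono) auto
    also have "\<dots> \<le> 3"
      by (simp add: card_insert_if)
    finally have three: "card (c ` E) = 3"
      using col by simp
    have "card (f \<inter> g) = 2" if "g \<in> E - {f}" "c g \<noteq> k" for g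
    proof -
      have "g \<notin> R" using R1 that by blast
      then have "c g = c e" using that by (simp add: R_def)
      then show ?thesis
        using cross[of f g] f that by (auto simp: R_def)
    qed
    moreover have "f \<in> E" "c f \<noteq> k" using f by (auto simp: R_def)
    ultimately have "around_edge k"
      unfolding around_edge_def by blast
    with three show ?thesis by simp
  qed
qed

lemma dominant_color_structure:
  assumes "3 \<le> card (c ` E)"
  shows "\<exists>k \<in> c ` E. common_pair k \<or> card (c ` E) \<in> {3, 4, 5} \<and> almost_common_vertex k
    \<or> card (c ` E) = 3 \<and> around_edge k"
proof -
  obtain k where k: "k \<in> c ` E"
    and cross: "\<And>e f. \<lbrakk>e \<in> E; f \<in> E; c e \<noteq> k; c f \<noteq> k; c e \<noteq> c f\<rbrakk> \<Longrightarrow> card (e \<inter> f) = 2"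
    using dominant_color[OF assms] by blast
  have "common_pair k \<or> card (c ` E) \<in> {3, 4, 5} \<and> almost_common_vertex k
    \<or> card (c ` E) = 3 \<and> around_edge k"
  proof (cases "\<exists>e\<in>E. \<exists>e'\<in>E. c e \<noteq> k \<and> c e' = c e \<and> e' \<noteq> e \<and> card (e \<inter> e') \<noteq> 2")
    case True
    then show ?thesis
      using structure_if_spread_class[OF assms cross] by blast
  next
    case False
    then show ?thesis
      \<comment> \<open>Distinct colors are covered by \<open>cross\<close>, equal colors by the
        failed case condition.\<close>
      using cross by (intro structure_if_pairwise[OF assms]) metis
  qed
  then show ?thesis using k by blast
qed

end

section \<open>From embeddings of the loose path to named vertices, and the conclusion\<close>

lemma no_rainbow_loose_path:
  assumes "\<not> has_rainbow_copy c loose_path (complete3 V)"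
    and D: "distinct [p, q, r, s, t, u, v]" "{p, q, r, s, t, u, v} \<subseteq> V"
  shows "c {p, q, r} = c {r, s, t} \<or> c {r, s, t} = c {t, u, v} \<or> c {p, q, r} = c {t, u, v}"
proof (rule ccontr)
  assume neg: "\<not> ?thesis"
  \<comment> \<open>The path has vertices 1 to 7, while list positions start at 0.\<close>
  define \<phi> where "\<phi> i = [p, q, r, s, t, u, v] ! (i - 1)" for i
  have vals: "\<phi> (Suc 0) = p" "\<phi> 2 = q" "\<phi> 3 = r" "\<phi> 4 = s" "\<phi> 5 = t" "\<phi> 6 = u" "\<phi> 7 = v"
    by (simp_all add: \<phi>_def)
  have "inj_on \<phi> {1..7}"
    using D(1) nth_eq_iff_index_eq[OF D(1)] by (force simp: inj_on_def \<phi>_def)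
  moreover have "\<phi> ` {1..7} \<subseteq> V"
  proof -
    have "{1..7} = {Suc 0, 2, 3, 4, 5, 6, 7}" by auto
    then show ?thesis using D(2) by (simp add: vals)
  qed
  ultimately have "is_copy \<phi> loose_path (complete3 V)"
    using D by (simp add: is_copy_def loose_path_def complete3_def vals)
  moreover have "inj_on c ((\<lambda>e. \<phi> ` e) ` edges loose_path)"
    using neg by (auto simp: loose_path_def vals inj_on_def)
  ultimately show False
    using assms(1) by (auto simp: has_rainbow_copy_def)
qed

theorem theorem4p1:
  fixes n :: nat and V :: "'a set" and G :: "'a hypergraph" and c :: "'a set \<Rightarrow> 'c"
  assumes "n \<ge> 7" and "finite V" and "card V = n"
    and "G = complete3 V"
    and "\<not> has_rainbow_copy c loose_path G"
    and "card (colors c G) \<ge> 3"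
  shows "\<exists>col1 \<in> colors c G.
     (\<exists>u\<in>verts G. \<exists>v\<in>verts G. u \<noteq> v \<and> (\<forall>e\<in>edges G. c e \<noteq> col1 \<longrightarrow> {u, v} \<subseteq> e))
   \<or> (card (colors c G) \<in> {3, 4, 5} \<and>
      (\<exists>v\<in>verts G. \<exists>F \<subseteq> edges (del_vert G v). card F \<le> 1 \<and>
         (\<exists>a. \<forall>f \<in> edges (del_vert G v) - F. c f = a)))
   \<or> (card (colors c G) = 3 \<and>
      (\<exists>e\<in>edges G. c e \<noteq> col1 \<and>
         (\<forall>f \<in> edges G - {e}. c f \<noteq> col1 \<longrightarrow> card (e \<inter> f) = 2)))"
proof -
  let ?E = "{e. e \<subseteq> V \<and> card e = 3}"
  interpret rainbow_loose_path_free V c ?E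
  proof unfold_locales
    show "finite V" "7 \<le> card V"
      using assms by simp_all
  qed (rule no_rainbow_loose_path[OF assms(5)[unfolded assms(4)]])
  have G: "verts G = V" "edges G = ?E" "colors c G = c ` ?E"
    using assms(4) by (simp_all add: complete3_def colors_def)
  obtain k where k: "k \<in> c ` ?E" and "common_pair k
      \<or> card (c ` ?E) \<in> {3, 4, 5} \<and> almost_common_vertex k
      \<or> card (c ` ?E) = 3 \<and> around_edge k"
    using dominant_color_structure assms(6) unfolding G by blast
  then consider "common_pair k" | "card (c ` ?E) \<in> {3, 4, 5}" "almost_common_vertex k"
    | "card (c ` ?E) = 3" "around_edge k"
    by argo
  then show ?thesis
  proof cases
    case 1
    then show ?thesis
      unfolding G common_pair_def by (intro bexI[OF _ k] disjI1)
  next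
    case 2
    from 2(2) obtain v g where v: "v \<in> V" "\<forall>e\<in>?E. c e \<noteq> k \<longrightarrow> v \<notin> e \<longrightarrow> e = g"
      unfolding almost_common_vertex_def by (elim bexE exE)
    \<comment> \<open>The intersection is empty when \<open>g\<close> is not an edge avoiding
      \<open>v\<close>. All edges outside it that avoid \<open>v\<close> have the dominant color
      \<open>k\<close>.\<close>
    let ?F = "edges (del_vert G v) \<inter> {g}"
    have "card ?F \<le> 1"
      by (rule order_trans[OF card_mono[of "{g}"]]) auto
    moreover have "c f = k" if "f \<in> edges (del_vert G v) - ?F" for f
    proof -
      have "f \<in> ?E" "v \<notin> f" "f \<noteq> g"
        using that by (auto simp: del_vert_def G)
      then show ?thesis
        using bspec[OF v(2), of f] by simp
    qed
    ultimately have "\<exists>F \<subseteq> edges (del_vert G v). card F \<le> 1 \<and>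
        (\<exists>a. \<forall>f \<in> edges (del_vert G v) - F. c f = a)"
      by (intro exI[of _ ?F] conjI exI[of _ k]) auto
    then show ?thesis
      unfolding G(1,3) by (intro bexI[OF _ k] disjI2 disjI1 conjI 2(1) bexI[OF _ v(1)])
  next
    case 3
    then show ?thesis
      unfolding G around_edge_def by (intro bexI[OF _ k] disjI2 conjI)
  qed
qed

end
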